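(* Let $G$ be a connected finite simple graph with $n\geq 3$ vertices, and let $X_G=\sum_{\lambda\vdash n} c_\lambda\,\mathfrak{st}_\lambda$ be the expansion of its chromatic symmetric function in the star basis. Then the coefficient $c_{21^{n-2}}$ (indexed by the partition of $n$ with one part equal to $2$ and $n-2$ parts equal to $1$) is nonzero if and only if $G$ is $2$-connected.
   Context: For a finite simple graph $G=(V,E)$, a proper colouring is a function $\kappa:V\to\{1,2,3,\ldots\}$ with $\kappa(u)\neq\kappa(v)$ whenever $\{u,v\}\in E$. The chromatic symmetric function of $G$ is $X_G=\sum_{\kappa\text{ proper}}\prod_{v\in V}x_{\kappa(v)}$, a symmetric function in commuting variables $x_1,x_2,\ldots$, homogeneous of degree $|V|$. The star $\mathrm{St}_k$ is the $k$-vertex tree in which $k-1$ leaves are joined to a single central vertex ($\mathrm{St}_1$ is a single vertex). For a partition $\lambda=(\lambda_1,\ldots,\lambda_\ell)$ of $n$, $\mathrm{St}_\lambda$ is the disjoint union of $\mathrm{St}_{\lambda_1},\ldots,\mathrm{St}_{\lambda_\ell}$, and $\mathfrak{st}_\lambda=X_{\mathrm{St}_\lambda}$. It is known that $\{\mathfrak{st}_\lambda:\lambda\vdash n\}$ is a basis (over $\mathbb{Q}$) of the space $\Lambda^n$ of symmetric functions of degree $n$, called the star basis. A graph $G$ is $2$-connected if it has at least three vertices and for every vertex $v$ the graph $G\setminus v$, obtained by deleting $v$ and all incident edges, is connected. *)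

theory Defs
  imports "Graph_Theory.Graph_Theory" "HOL-Library.Multiset" "HOL-Library.FuncSet"
begin

text \<open>
  A finite simple graph is a \<open>pair_graph\<close>: an edge \<open>{u,v}\<close> is represented by the two
  arcs \<open>(u,v)\<close> and \<open>(v,u)\<close>.
\<close>

definition two_connected :: "'a pair_pre_digraph \<Rightarrow> bool" where
  "two_connected G \<longleftrightarrow> card (pverts G) \<ge> 3 \<and>
     (\<forall>v \<in> pverts G. Digraph_Component.connected (pre_digraph.del_vert (with_proj G) v))"

text \<open>Colourings are extensional, so that each function on the vertex set occurs exactly once.\<close>

definition proper_colourings :: "'a pair_pre_digraph \<Rightarrow> ('a \<Rightarrow> nat) set" where
  "proper_colourings G =
     {\<kappa> \<in> pverts G \<rightarrow>\<^sub>E {1..}. \<forall>(u, v) \<in> parcs G. \<kappa> u \<noteq> \<kappa> v}"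

text \<open>
  A formal power series over the rationals in commuting variables \<open>x\<^sub>1, x\<^sub>2, \<dots>\<close> is given by
  its coefficients; a monomial is the multiset of the indices of its variables, e.g.
  \<open>{#1, 1, 3#}\<close> is \<open>x\<^sub>1\<^sup>2 x\<^sub>3\<close>.
\<close>

type_synonym series = "nat multiset \<Rightarrow> rat"

text \<open>
  The monomial of a colouring \<open>\<kappa>\<close> is the product of \<open>x\<^bsub>\<kappa>(v)\<^esub>\<close> over all vertices \<open>v\<close>;
  the coefficient of \<open>m\<close> in the sum over all proper colourings is the number of proper
  colourings with monomial \<open>m\<close>, which is finite by \<open>finite_colourings_with_monomial\<close> below.
\<close>

definition colouring_monomial :: "'a pair_pre_digraph \<Rightarrow> ('a \<Rightarrow> nat) \<Rightarrow> nat multiset" where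
  "colouring_monomial G \<kappa> = image_mset \<kappa> (mset_set (pverts G))"

definition chromatic_symmetric_function :: "'a pair_pre_digraph \<Rightarrow> series" where
  "chromatic_symmetric_function G =
     (\<lambda>m. of_nat (card {\<kappa> \<in> proper_colourings G. colouring_monomial G \<kappa> = m}))"

lemma finite_colourings_with_monomial:
  assumes "finite (pverts G)"
  shows "finite {\<kappa> \<in> proper_colourings G. colouring_monomial G \<kappa> = m}"
proof (rule finite_subset)
  show "{\<kappa> \<in> proper_colourings G. colouring_monomial G \<kappa> = m} \<subseteq> pverts G \<rightarrow>\<^sub>E set_mset m"
    using assms by (auto simp: proper_colourings_def colouring_monomial_def PiE_iff extensional_def)
  show "finite (pverts G \<rightarrow>\<^sub>E set_mset m)"
    using assms by (intro finite_PiE) auto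
qed

definition partitions :: "nat \<Rightarrow> nat list set" where
  "partitions n = {l. sorted_wrt (\<ge>) l \<and> (\<forall>k \<in> set l. k \<ge> 1) \<and> sum_list l = n}"

lemma finite_partitions: "finite (partitions n)"
proof (rule finite_subset)
  have "length l \<le> sum_list l" if "\<forall>k \<in> set l. k \<ge> 1" for l :: "nat list"
    using that by (induction l) auto
  then show "partitions n \<subseteq> {l. set l \<subseteq> {..n} \<and> length l \<le> n}"
    by (auto simp: partitions_def dest: member_le_sum_list)
  show "finite {l. set l \<subseteq> {..n} \<and> length l \<le> n}"
    by (rule finite_lists_length_le) simp
qed

text \<open>The central vertex of the star is \<open>0\<close>.\<close>

definition star :: "nat \<Rightarrow> nat pair_pre_digraph" where
  "star k = \<lparr> pverts = {..<k}, parcs = (\<Union>j \<in> {1..<k}. {(0, j), (j, 0)}) \<rparr>"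

definition disjoint_union :: "'a pair_pre_digraph list \<Rightarrow> (nat \<times> 'a) pair_pre_digraph" where
  "disjoint_union Gs =
     \<lparr> pverts = {(i, v). i < length Gs \<and> v \<in> pverts (Gs ! i)},
       parcs = {((i, u), (i, v)) |i u v. i < length Gs \<and> (u, v) \<in> parcs (Gs ! i)} \<rparr>"

definition star_forest :: "nat list \<Rightarrow> (nat \<times> nat) pair_pre_digraph" where
  "star_forest l = disjoint_union (map star l)"

definition star_basis :: "nat list \<Rightarrow> series" where
  "star_basis l = chromatic_symmetric_function (star_forest l)"

lemma pair_graph_star: "pair_graph (star k)"
  by unfold_locales (auto simp: star_def symmetric_def sym_def)

lemma pair_graph_disjoint_union:
  assumes "\<And>H. H \<in> set Gs \<Longrightarrow> pair_graph H"
  shows "pair_graph (disjoint_union Gs)"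
proof -
  have g: "pair_graph (Gs ! i)" if "i < length Gs" for i
    using assms that by auto
  have v: "u \<in> pverts (Gs ! i) \<and> v \<in> pverts (Gs ! i) \<and> u \<noteq> v \<and> (v, u) \<in> parcs (Gs ! i)"
    if "i < length Gs" "(u, v) \<in> parcs (Gs ! i)" for i u v
  proof -
    interpret pair_graph "Gs ! i" using g that by blast
    show ?thesis
      using that in_arcsD1 in_arcsD2 pair_no_loops pair_sym_arcs
      by (fastforce simp: symmetric_def dest: symD)
  qed
  have "pverts (disjoint_union Gs) = (SIGMA i:{..<length Gs}. pverts (Gs ! i))"
    by (auto simp: disjoint_union_def)
  moreover have "finite (pverts (Gs ! i))" if "i < length Gs" for i
    using g[OF that] pair_fin_digraph.pair_finite_verts
    by (auto simp: pair_graph_def pair_digraph_def)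
  ultimately have f: "finite (pverts (disjoint_union Gs))"
    by auto
  have "parcs (disjoint_union Gs) \<subseteq> pverts (disjoint_union Gs) \<times> pverts (disjoint_union Gs)"
    using v by (auto simp: disjoint_union_def)
  with f have "finite (parcs (disjoint_union Gs))"
    by (meson finite_SigmaI finite_subset)
  with f show ?thesis
    by unfold_locales (use v in \<open>auto simp: disjoint_union_def symmetric_def sym_def\<close>)
qed

lemma pair_graph_star_forest: "pair_graph (star_forest l)"
  by (auto simp: star_forest_def intro!: pair_graph_disjoint_union pair_graph_star)

end

theory Submission
  imports Defs "HOL-Computational_Algebra.Polynomial"
begin

text \<open>
  Setting \<open>x\<^sub>1 = \<dots> = x\<^sub>q = 1\<close> and all other variables to \<open>0\<close> turns \<open>X\<^bsub>G\<^esub>\<close> into the number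
  \<open>\<chi>\<^bsub>G\<^esub>(q)\<close> of proper colourings with \<open>q\<close> colours. A forest of \<open>l\<close> stars on \<open>n\<close> vertices has
  \<open>q\<^sup>l (q - 1)\<^bsup>n - l\<^esup>\<close> such colourings, so the expansion in the star basis becomes
  \<open>\<chi>\<^bsub>G\<^esub>(q) = \<Sum> c\<^sub>\<lambda> q\<^sup>l (q - 1)\<^bsup>n - l\<^esup>\<close> with \<open>l\<close> the length of \<open>\<lambda>\<close>. At \<open>q = 1\<close> only the
  term of \<open>1\<^sup>n\<close> survives, and its coefficient vanishes because \<open>G\<close> has an edge. The derivative at
  \<open>q = 1\<close> then picks out exactly the partition with \<open>n - l = 1\<close>. Hence the coefficient in question
  is \<open>\<chi>\<^bsub>G\<^esub>'(1)\<close>, up to sign Crapo's beta invariant of the graphic matroid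
  (\<open>star_coefficient_eq_pderiv\<close>).

  It remains to see that \<open>\<chi>\<^bsub>G\<^esub>'(1) \<noteq> 0\<close> exactly if the connected graph \<open>G\<close> has no cut vertex
  (\<open>pderiv_chromatic_polynomial_sign\<close>). If \<open>w\<close> is a cut vertex, then \<open>G\<close> is glued at \<open>w\<close> from two
  graphs with at least one edge each, and \<open>q \<chi>\<^bsub>G\<^esub> = \<chi>\<^sub>1 \<chi>\<^sub>2\<close> has a double root at \<open>1\<close>. If there is
  no cut vertex, then \<open>(-1)\<^sup>n \<chi>\<^bsub>G\<^esub>'(1) > 0\<close> by induction: deletion and contraction of an edge make
  this number the sum of the corresponding numbers of \<open>G \ e\<close> and \<open>G / e\<close>, both non-negative by
  induction, and by a theorem of Tutte one of these two graphs again has no cut vertex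
  (\<open>biconnected_contract\<close>, \<open>biconnected_delete_edge\<close>).
\<close>

section \<open>Counting colourings\<close>

text \<open>
  The edge relation is an arbitrary set of pairs: contracting an edge may then create loops, which
  rule out every colouring, and one direction of an edge constrains as much as both.
\<close>

definition colourings :: "'a set \<Rightarrow> 'a rel \<Rightarrow> nat \<Rightarrow> ('a \<Rightarrow> nat) set" where
  "colourings V E q = {\<kappa> \<in> V \<rightarrow>\<^sub>E {1..q}. \<forall>(x, y) \<in> E. \<kappa> x \<noteq> \<kappa> y}"

lemma colouringsI:
  assumes "\<And>x. x \<in> V \<Longrightarrow> \<kappa> x \<in> {1..q}" "\<And>x. x \<notin> V \<Longrightarrow> \<kappa> x = undefined"
    and "\<And>x y. (x, y) \<in> E \<Longrightarrow> \<kappa> x \<noteq> \<kappa> y"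
  shows "\<kappa> \<in> colourings V E q"
  using assms by (auto simp: colourings_def PiE_iff extensional_def)

lemma colouringsD:
  assumes "\<kappa> \<in> colourings V E q"
  shows "x \<in> V \<Longrightarrow> \<kappa> x \<in> {1..q}" "x \<notin> V \<Longrightarrow> \<kappa> x = undefined"
    "(x, y) \<in> E \<Longrightarrow> \<kappa> x \<noteq> \<kappa> y"
  using assms by (fastforce simp: colourings_def PiE_iff extensional_def)+

lemma finite_colourings: "finite V \<Longrightarrow> finite (colourings V E q)"
  by (rule finite_subset[of _ "V \<rightarrow>\<^sub>E {1..q}"]) (auto simp: colourings_def intro!: finite_PiE)

lemma card_colourings_empty: "finite V \<Longrightarrow> card (colourings V {} q) = q ^ card V"
  by (simp add: colourings_def card_PiE)

lemma colourings_loop: "(x, x) \<in> E \<Longrightarrow> colourings V E q = {}"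
  by (auto dest: colouringsD(3))

lemma colourings_one_empty:
  assumes "(x, y) \<in> E" "x \<in> V" "y \<in> V"
  shows "colourings V E 1 = {}"
proof -
  have False if "\<kappa> \<in> colourings V E 1" for \<kappa>
    using colouringsD(1)[OF that assms(2)] colouringsD(1)[OF that assms(3)]
      colouringsD(3)[OF that assms(1)] by simp
  then show ?thesis by blast
qed

lemma card_colourings_isolated:
  assumes "v \<notin> V" "E \<subseteq> V \<times> V"
  shows "card (colourings (insert v V) E q) = q * card (colourings V E q)"
proof -
  have "bij_betw (\<lambda>(c, \<kappa>). \<kappa>(v := c)) ({1..q} \<times> colourings V E q) (colourings (insert v V) E q)"
  proof (rule bij_betw_byWitness[where f' = "\<lambda>\<kappa>. (\<kappa> v, \<kappa>(v := undefined))"])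
    show "\<forall>p \<in> {1..q} \<times> colourings V E q.
        (\<lambda>\<kappa>. (\<kappa> v, \<kappa>(v := undefined))) ((\<lambda>(c, \<kappa>). \<kappa>(v := c)) p) = p"
      using assms by (auto simp: fun_eq_iff dest: colouringsD(2))
    show "\<forall>\<kappa> \<in> colourings (insert v V) E q.
        (\<lambda>(c, \<kappa>). \<kappa>(v := c)) (\<kappa> v, \<kappa>(v := undefined)) = \<kappa>"
      by simp
    have "\<kappa>(v := c) \<in> colourings (insert v V) E q"
      if c: "c \<in> {1..q}" and \<kappa>: "\<kappa> \<in> colourings V E q" for c \<kappa>
    proof (rule colouringsI)
      show "(\<kappa>(v := c)) x \<in> {1..q}" if "x \<in> insert v V" for x
        using that c colouringsD(1)[OF \<kappa>, of x] by auto
      show "(\<kappa>(v := c)) x = undefined" if "x \<notin> insert v V" for x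
        using that colouringsD(2)[OF \<kappa>] by auto
      show "(\<kappa>(v := c)) x \<noteq> (\<kappa>(v := c)) y" if "(x, y) \<in> E" for x y
        using that assms colouringsD(3)[OF \<kappa> that] by auto
    qed
    then show "(\<lambda>(c, \<kappa>). \<kappa>(v := c)) ` ({1..q} \<times> colourings V E q) \<subseteq> colourings (insert v V) E q"
      by auto
    have "\<kappa>(v := undefined) \<in> colourings V E q"
      if \<kappa>: "\<kappa> \<in> colourings (insert v V) E q" for \<kappa>
    proof (rule colouringsI)
      show "(\<kappa>(v := undefined)) x \<in> {1..q}" if "x \<in> V" for x
        using that assms colouringsD(1)[OF \<kappa>, of x] by auto
      show "(\<kappa>(v := undefined)) x = undefined" if "x \<notin> V" for x
        using that colouringsD(2)[OF \<kappa>] by auto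
      show "(\<kappa>(v := undefined)) x \<noteq> (\<kappa>(v := undefined)) y" if "(x, y) \<in> E" for x y
        using that assms colouringsD(3)[OF \<kappa> that] by auto
    qed
    then show "(\<lambda>\<kappa>. (\<kappa> v, \<kappa>(v := undefined))) ` colourings (insert v V) E q
        \<subseteq> {1..q} \<times> colourings V E q"
      using colouringsD(1) by fastforce
  qed
  then show ?thesis
    by (metis bij_betw_same_card card_cartesian_product card_atLeastAtMost diff_Suc_1)
qed

text \<open>
  The vertex \<open>v\<close> is merged into \<open>u\<close>; parallel edges collapse because the result is a set.
\<close>

definition contract :: "'a \<Rightarrow> 'a \<Rightarrow> 'a rel \<Rightarrow> 'a rel" where
  "contract u v E = map_prod (id(v := u)) (id(v := u)) ` E"

lemma contractI: "(x, y) \<in> E \<Longrightarrow> ((id(v := u)) x, (id(v := u)) y) \<in> contract u v E"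
  by (force simp: contract_def)

lemma contractE:
  assumes "(x, y) \<in> contract u v E"
  obtains a b where "(a, b) \<in> E" "x = (id(v := u)) a" "y = (id(v := u)) b"
  using assms unfolding contract_def by (elim imageE) (metis map_prod_simp prod.collapse prod.inject)

text \<open>
  Deletion and contraction, phrased as the addition of an edge: a colouring either separates \<open>u\<close>
  and \<open>v\<close>, or it descends to the graph in which they are identified.
\<close>

lemma card_colourings_contract:
  assumes "finite V" "E \<subseteq> V \<times> V" "u \<in> V" "v \<in> V" "u \<noteq> v"
  shows "card (colourings V E q) =
    card (colourings V (E \<union> {(u, v), (v, u)}) q) + card (colourings (V - {v}) (contract u v E) q)"
proof -
  let ?S = "{\<kappa> \<in> colourings V E q. \<kappa> u = \<kappa> v}"
  have split: "colourings V E q = colourings V (E \<union> {(u, v), (v, u)}) q \<union> ?S"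
    "colourings V (E \<union> {(u, v), (v, u)}) q \<inter> ?S = {}"
    by (auto simp: colourings_def)
  have "bij_betw (\<lambda>\<kappa>. \<kappa>(v := undefined)) ?S (colourings (V - {v}) (contract u v E) q)"
  proof (rule bij_betw_byWitness[where f' = "\<lambda>\<kappa>. \<kappa>(v := \<kappa> u)"])
    show "\<forall>\<kappa> \<in> ?S. (\<lambda>\<kappa>. \<kappa>(v := \<kappa> u)) (\<kappa>(v := undefined)) = \<kappa>"
      using assms(5) by (auto simp: fun_eq_iff)
    show "\<forall>\<kappa> \<in> colourings (V - {v}) (contract u v E) q. (\<kappa>(v := \<kappa> u))(v := undefined) = \<kappa>"
      by (auto simp: fun_eq_iff dest: colouringsD(2))
    have "\<kappa>(v := undefined) \<in> colourings (V - {v}) (contract u v E) q"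
      if \<kappa>: "\<kappa> \<in> colourings V E q" "\<kappa> u = \<kappa> v" for \<kappa>
    proof (rule colouringsI)
      show "(\<kappa>(v := undefined)) x \<in> {1..q}" if "x \<in> V - {v}" for x
        using that colouringsD(1)[OF \<kappa>(1), of x] by auto
      show "(\<kappa>(v := undefined)) x = undefined" if "x \<notin> V - {v}" for x
        using that colouringsD(2)[OF \<kappa>(1)] by auto
      fix x y assume "(x, y) \<in> contract u v E"
      then obtain a b where ab: "(a, b) \<in> E" "x = (id(v := u)) a" "y = (id(v := u)) b"
        by (rule contractE)
      then show "(\<kappa>(v := undefined)) x \<noteq> (\<kappa>(v := undefined)) y"
        using colouringsD(3)[OF \<kappa>(1) ab(1)] \<kappa>(2) assms(5) by auto
    qed
    then show "(\<lambda>\<kappa>. \<kappa>(v := undefined)) ` ?S \<subseteq> colourings (V - {v}) (contract u v E) q"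
      by auto
    have "\<kappa>(v := \<kappa> u) \<in> ?S" if \<kappa>: "\<kappa> \<in> colourings (V - {v}) (contract u v E) q" for \<kappa>
    proof -
      have "\<kappa>(v := \<kappa> u) \<in> colourings V E q"
      proof (rule colouringsI)
        show "(\<kappa>(v := \<kappa> u)) x \<in> {1..q}" if "x \<in> V" for x
          using that assms colouringsD(1)[OF \<kappa>, of x] colouringsD(1)[OF \<kappa>, of u] by auto
        show "(\<kappa>(v := \<kappa> u)) x = undefined" if "x \<notin> V" for x
          using that assms colouringsD(2)[OF \<kappa>, of x] by auto
        show "(\<kappa>(v := \<kappa> u)) x \<noteq> (\<kappa>(v := \<kappa> u)) y" if "(x, y) \<in> E" for x y
          using colouringsD(3)[OF \<kappa> contractI[OF that]] by (auto split: if_splits)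
      qed
      then show ?thesis using assms(5) by simp
    qed
    then show "(\<lambda>\<kappa>. \<kappa>(v := \<kappa> u)) ` colourings (V - {v}) (contract u v E) q \<subseteq> ?S"
      by blast
  qed
  then have "card ?S = card (colourings (V - {v}) (contract u v E) q)"
    by (rule bij_betw_same_card)
  moreover have "card (colourings V E q) = card (colourings V (E \<union> {(u, v), (v, u)}) q) + card ?S"
    by (subst split(1), rule card_Un_disjoint)
      (use split(2) finite_colourings[OF assms(1)] in auto)
  ultimately show ?thesis by simp
qed

text \<open>
  Transposing two colours is a bijection between the colourings that give \<open>w\<close> the one and those
  that give it the other, so every colour of \<open>w\<close> is equally frequent.
\<close>

lemma card_colourings_rooted:
  assumes "finite V" "E \<subseteq> V \<times> V" "w \<in> V" "c \<in> {1..q}"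
  shows "card (colourings V E q) = q * card {\<kappa> \<in> colourings V E q. \<kappa> w = c}"
proof -
  let ?R = "\<lambda>d. {\<kappa> \<in> colourings V E q. \<kappa> w = d}"
  let ?g = "\<lambda>a b \<kappa>. restrict (Transposition.transpose a b \<circ> \<kappa>) V"
  have swap: "?g a b \<kappa> \<in> ?R b" if "a \<in> {1..q}" "b \<in> {1..q}" "\<kappa> \<in> ?R a" for a b \<kappa>
  proof -
    have \<kappa>: "\<kappa> \<in> colourings V E q" using that by simp
    have "?g a b \<kappa> \<in> colourings V E q"
    proof (rule colouringsI)
      show "?g a b \<kappa> x \<in> {1..q}" if "x \<in> V" for x
        using that colouringsD(1)[OF \<kappa>, of x] \<open>a \<in> _\<close> \<open>b \<in> _\<close>
        by (auto simp: Transposition.transpose_def)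
      show "?g a b \<kappa> x \<noteq> ?g a b \<kappa> y" if "(x, y) \<in> E" for x y
        using that assms(2) colouringsD(3)[OF \<kappa> that] by (auto simp: Transposition.transpose_eq_iff)
    qed simp
    then show ?thesis using that(3) assms(3) by simp
  qed
  have inv: "?g b a (?g a b \<kappa>) = \<kappa>" if "\<kappa> \<in> ?R a" for a b \<kappa>
  proof
    have \<kappa>: "\<kappa> \<in> colourings V E q" using that by simp
    show "?g b a (?g a b \<kappa>) x = \<kappa> x" for x
      using colouringsD(2)[OF \<kappa>, of x]
      by (cases "x \<in> V") (simp_all add: Transposition.transpose_commute[of b a])
  qed
  have "card (?R d) = card (?R c)" if "d \<in> {1..q}" for d
  proof (rule bij_betw_same_card[of "?g d c"], rule bij_betw_byWitness[where f' = "?g c d"])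
    show "\<forall>\<kappa> \<in> ?R d. ?g c d (?g d c \<kappa>) = \<kappa>" "\<forall>\<kappa> \<in> ?R c. ?g d c (?g c d \<kappa>) = \<kappa>"
      by (intro ballI inv; assumption)+
    show "?g d c ` ?R d \<subseteq> ?R c" "?g c d ` ?R c \<subseteq> ?R d"
      by (intro image_subsetI swap that assms(4); assumption)+
  qed
  then have "(\<Sum>d\<in>{1..q}. card (?R d)) = q * card (?R c)"
    by simp
  moreover have "card (\<Union>d\<in>{1..q}. ?R d) = (\<Sum>d\<in>{1..q}. card (?R d))"
    by (rule card_UN_disjoint) (auto simp: finite_colourings[OF assms(1)])
  moreover have "(\<Union>d\<in>{1..q}. ?R d) = colourings V E q"
    using colouringsD(1)[OF _ assms(3)] by blast
  ultimately show ?thesis by simp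
qed

text \<open>
  Once the colour of the shared vertex is fixed, the two sides are coloured independently.
\<close>

lemma card_colourings_rooted_glue:
  assumes fin: "finite V1" "finite V2" and int: "V1 \<inter> V2 = {w}"
    and E: "E1 \<subseteq> V1 \<times> V1" "E2 \<subseteq> V2 \<times> V2"
  shows "card {\<kappa> \<in> colourings (V1 \<union> V2) (E1 \<union> E2) q. \<kappa> w = c} =
    card {\<kappa> \<in> colourings V1 E1 q. \<kappa> w = c} * card {\<kappa> \<in> colourings V2 E2 q. \<kappa> w = c}"
    (is "card ?R = card ?R1 * card ?R2")
proof -
  let ?f = "\<lambda>\<kappa>. (restrict \<kappa> V1, restrict \<kappa> V2)"
  let ?g = "\<lambda>(\<kappa>1, \<kappa>2). \<lambda>x. if x \<in> V1 then \<kappa>1 x else \<kappa>2 x"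
  have w: "w \<in> V1" "w \<in> V2" using int by auto
  have "bij_betw ?f ?R (?R1 \<times> ?R2)"
  proof (rule bij_betw_byWitness[where f' = ?g])
    show "\<forall>\<kappa> \<in> ?R. ?g (?f \<kappa>) = \<kappa>"
    proof
      fix \<kappa> assume "\<kappa> \<in> ?R"
      then have \<kappa>: "\<kappa> \<in> colourings (V1 \<union> V2) (E1 \<union> E2) q" by simp
      show "?g (?f \<kappa>) = \<kappa>"
      proof
        show "?g (?f \<kappa>) x = \<kappa> x" for x
          using colouringsD(2)[OF \<kappa>, of x] by (cases "x \<in> V1"; cases "x \<in> V2") simp_all
      qed
    qed
    show "\<forall>p \<in> ?R1 \<times> ?R2. ?f (?g p) = p"
    proof
      fix p assume "p \<in> ?R1 \<times> ?R2"
      then obtain \<kappa>1 \<kappa>2 where p: "p = (\<kappa>1, \<kappa>2)"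
        and \<kappa>: "\<kappa>1 \<in> colourings V1 E1 q" "\<kappa>2 \<in> colourings V2 E2 q" "\<kappa>1 w = c" "\<kappa>2 w = c"
        by auto
      have "restrict (?g (\<kappa>1, \<kappa>2)) V1 = \<kappa>1"
      proof
        show "restrict (?g (\<kappa>1, \<kappa>2)) V1 x = \<kappa>1 x" for x
          using colouringsD(2)[OF \<kappa>(1), of x] by (cases "x \<in> V1") simp_all
      qed
      moreover have "restrict (?g (\<kappa>1, \<kappa>2)) V2 = \<kappa>2"
      proof
        fix x show "restrict (?g (\<kappa>1, \<kappa>2)) V2 x = \<kappa>2 x"
        proof (cases "x \<in> V1 \<inter> V2")
          case True
          then have "x = w" using int by blast
          then show ?thesis using w \<kappa>(3,4) by simp
        next
          case False
          then show ?thesis using colouringsD(2)[OF \<kappa>(2), of x] by (cases "x \<in> V2") simp_all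
        qed
      qed
      ultimately show "?f (?g p) = p"
        by (simp only: p prod.case)
    qed
    have sub: "restrict \<kappa> V' \<in> colourings V' E' q"
      if "\<kappa> \<in> colourings V E q" "V' \<subseteq> V" "E' \<subseteq> E" "E' \<subseteq> V' \<times> V'" for \<kappa> :: "'a \<Rightarrow> nat" and V V' E E'
    proof (rule colouringsI)
      show "restrict \<kappa> V' x \<in> {1..q}" if "x \<in> V'" for x
        using that \<open>V' \<subseteq> V\<close> colouringsD(1)[OF \<open>\<kappa> \<in> _\<close>, of x] by auto
      show "restrict \<kappa> V' x \<noteq> restrict \<kappa> V' y" if "(x, y) \<in> E'" for x y
        using that \<open>E' \<subseteq> E\<close> \<open>E' \<subseteq> V' \<times> V'\<close> colouringsD(3)[OF \<open>\<kappa> \<in> _\<close>, of x y] by auto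
    qed simp
    have "restrict \<kappa> V1 \<in> ?R1" "restrict \<kappa> V2 \<in> ?R2" if "\<kappa> \<in> ?R" for \<kappa>
    proof -
      have \<kappa>: "\<kappa> \<in> colourings (V1 \<union> V2) (E1 \<union> E2) q" "\<kappa> w = c" using that by auto
      show "restrict \<kappa> V1 \<in> ?R1" "restrict \<kappa> V2 \<in> ?R2"
        using sub[OF \<kappa>(1) Un_upper1 Un_upper1 E(1)] sub[OF \<kappa>(1) Un_upper2 Un_upper2 E(2)] \<kappa>(2) w
        by simp_all
    qed
    then show "?f ` ?R \<subseteq> ?R1 \<times> ?R2"
      by blast
    have "?g (\<kappa>1, \<kappa>2) \<in> ?R"
      if \<kappa>: "\<kappa>1 \<in> colourings V1 E1 q" "\<kappa>2 \<in> colourings V2 E2 q" "\<kappa>1 w = c" "\<kappa>2 w = c" for \<kappa>1 \<kappa>2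
    proof -
      have g2: "?g (\<kappa>1, \<kappa>2) x = \<kappa>2 x" if "x \<in> V2" for x
      proof (cases "x \<in> V1")
        case True
        then have "x = w" using that int by blast
        then show ?thesis using w \<kappa>(3,4) by simp
      qed simp
      have "?g (\<kappa>1, \<kappa>2) \<in> colourings (V1 \<union> V2) (E1 \<union> E2) q"
      proof (rule colouringsI)
        show "?g (\<kappa>1, \<kappa>2) x \<in> {1..q}" if "x \<in> V1 \<union> V2" for x
          using that colouringsD(1)[OF \<kappa>(1), of x] colouringsD(1)[OF \<kappa>(2), of x] by auto
        show "?g (\<kappa>1, \<kappa>2) x = undefined" if "x \<notin> V1 \<union> V2" for x
          using that colouringsD(2)[OF \<kappa>(2), of x] by auto
        fix x y assume "(x, y) \<in> E1 \<union> E2"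
        then show "?g (\<kappa>1, \<kappa>2) x \<noteq> ?g (\<kappa>1, \<kappa>2) y"
        proof
          assume "(x, y) \<in> E1"
          then show ?thesis using E(1) colouringsD(3)[OF \<kappa>(1)] by auto
        next
          assume xy: "(x, y) \<in> E2"
          then have "x \<in> V2" "y \<in> V2" using E(2) by auto
          then show ?thesis using colouringsD(3)[OF \<kappa>(2) xy] by (simp only: g2 not_False_eq_True)
        qed
      qed
      then show ?thesis using \<kappa>(3) w by simp
    qed
    note glued = this
    show "?g ` (?R1 \<times> ?R2) \<subseteq> ?R"
    proof (rule image_subsetI)
      fix p assume "p \<in> ?R1 \<times> ?R2"
      then obtain \<kappa>1 \<kappa>2 where p: "p = (\<kappa>1, \<kappa>2)"
        and \<kappa>: "\<kappa>1 \<in> colourings V1 E1 q" "\<kappa>2 \<in> colourings V2 E2 q" "\<kappa>1 w = c" "\<kappa>2 w = c"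
        by auto
      show "?g p \<in> ?R" unfolding p by (rule glued[OF \<kappa>])
    qed
  qed
  then have "card ?R = card (?R1 \<times> ?R2)" by (rule bij_betw_same_card)
  then show ?thesis by (simp only: card_cartesian_product)
qed

lemma card_colourings_glue:
  assumes "finite V1" "finite V2" "V1 \<inter> V2 = {w}" "E1 \<subseteq> V1 \<times> V1" "E2 \<subseteq> V2 \<times> V2"
  shows "q * card (colourings (V1 \<union> V2) (E1 \<union> E2) q) =
    card (colourings V1 E1 q) * card (colourings V2 E2 q)"
proof (cases "q = 0")
  case True
  have "colourings V1 E1 0 = {}"
    using assms(3) colouringsD(1)[of _ V1 E1 0 w] by auto
  with True show ?thesis by simp
next
  case False
  then have 1: "1 \<in> {1..q}" by simp
  have w: "w \<in> V1" "w \<in> V2" using assms(3) by auto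
  have "E1 \<union> E2 \<subseteq> (V1 \<union> V2) \<times> (V1 \<union> V2)" using assms by blast
  from card_colourings_rooted[OF _ this _ 1, of w]
    card_colourings_rooted[OF assms(1,4) w(1) 1] card_colourings_rooted[OF assms(2,5) w(2) 1]
    card_colourings_rooted_glue[OF assms]
  show ?thesis using assms(1,2) w by (simp add: algebra_simps)
qed

section \<open>Chromatic polynomials\<close>

lemma poly_eqI_naturals:
  fixes p p' :: "rat poly"
  assumes "\<And>q. poly p (of_nat q) = poly p' (of_nat q)"
  shows "p = p'"
proof -
  have "range of_nat \<subseteq> {x. poly (p - p') x = 0}"
    using assms by auto
  moreover have "infinite (range (of_nat :: nat \<Rightarrow> rat))"
    by (simp add: finite_image_iff inj_on_def)
  ultimately have "infinite {x. poly (p - p') x = 0}"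
    using finite_subset by blast
  then have "p - p' = 0" using poly_roots_finite by blast
  then show ?thesis by simp
qed

lemma contract_subset:
  "E \<subseteq> V \<times> V \<Longrightarrow> u \<in> V \<Longrightarrow> u \<noteq> v \<Longrightarrow> contract u v E \<subseteq> (V - {v}) \<times> (V - {v})"
  by (auto simp: contract_def split: if_splits)

text \<open>
  Deletion and contraction reduce the count to that of graphs without edges. The induction is over
  all relations, so the contracted relation need not be simple.
\<close>

lemma ex_chromatic_polynomial:
  assumes "finite V" "E \<subseteq> V \<times> V"
  shows "\<exists>p :: rat poly. \<forall>q. poly p (of_nat q) = of_nat (card (colourings V E q))"
  using assms
proof (induction "card V + card E" arbitrary: V E rule: less_induct)
  case less
  have fE: "finite E" using less.prems by (meson finite_SigmaI finite_subset)
  consider "E = {}" | u where "(u, u) \<in> E" | u v where "(u, v) \<in> E" "u \<noteq> v"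
    by (metis ex_in_conv prod.collapse)
  then show ?case
  proof cases
    case 1
    then show ?thesis
      using less.prems by (intro exI[of _ "monom 1 (card V)"]) (simp add: card_colourings_empty poly_monom)
  next
    case 2
    then show ?thesis by (intro exI[of _ 0]) (simp add: colourings_loop)
  next
    case (3 u v)
    define E0 where "E0 = E - {(u, v), (v, u)}"
    have uv: "u \<in> V" "v \<in> V" using 3 less.prems by auto
    have E0: "E0 \<subseteq> V \<times> V" "card E0 < card E"
      using 3 less.prems fE unfolding E0_def by (blast, intro psubset_card_mono) auto
    have "card (V - {v}) < card V" using uv less.prems(1) by (intro card_Diff1_less)
    moreover have "card (contract u v E0) \<le> card E0"
      unfolding contract_def by (rule card_image_le) (simp add: E0_def fE)
    ultimately have "card (V - {v}) + card (contract u v E0) < card V + card E"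
      using E0 by linarith
    moreover have "contract u v E0 \<subseteq> (V - {v}) \<times> (V - {v})"
      using E0(1) uv(1) 3(2) by (rule contract_subset)
    ultimately obtain p1 :: "rat poly" where
      p1: "\<And>q. poly p1 (of_nat q) = of_nat (card (colourings (V - {v}) (contract u v E0) q))"
      using less.hyps[of "V - {v}" "contract u v E0"] less.prems(1) by auto
    obtain p0 :: "rat poly" where
      p0: "\<And>q. poly p0 (of_nat q) = of_nat (card (colourings V E0 q))"
      using less.hyps[of V E0] less.prems(1) E0 by auto
    have "colourings V (E0 \<union> {(u, v), (v, u)}) q = colourings V E q" for q
    proof -
      have "E0 \<union> {(u, v), (v, u)} = insert (v, u) E"
        using 3(1) by (auto simp: E0_def)
      moreover have "colourings V (insert (v, u) E) q = colourings V E q"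
        using 3(1) by (fastforce simp: colourings_def)
      ultimately show ?thesis by simp
    qed
    then have "card (colourings V E0 q) =
        card (colourings V E q) + card (colourings (V - {v}) (contract u v E0) q)" for q
      using card_colourings_contract[OF less.prems(1) E0(1) uv 3(2), of q] by simp
    then show ?thesis
      by (intro exI[of _ "p0 - p1"]) (simp add: p0 p1)
  qed
qed

definition chromatic_polynomial :: "'a set \<Rightarrow> 'a rel \<Rightarrow> rat poly" where
  "chromatic_polynomial V E =
    (SOME p. \<forall>q. poly p (of_nat q) = of_nat (card (colourings V E q)))"

lemma poly_chromatic_polynomial:
  assumes "finite V" "E \<subseteq> V \<times> V"
  shows "poly (chromatic_polynomial V E) (of_nat q) = of_nat (card (colourings V E q))"
  using someI_ex[OF ex_chromatic_polynomial[OF assms]] by (simp add: chromatic_polynomial_def)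

lemma chromatic_polynomial_empty:
  "finite V \<Longrightarrow> chromatic_polynomial V {} = monom 1 (card V)"
  by (rule poly_eqI_naturals)
    (simp add: poly_chromatic_polynomial card_colourings_empty poly_monom)

lemma chromatic_polynomial_isolated:
  assumes "finite V" "v \<notin> V" "E \<subseteq> V \<times> V"
  shows "chromatic_polynomial (insert v V) E = [:0, 1:] * chromatic_polynomial V E"
proof (rule poly_eqI_naturals)
  fix q
  have "E \<subseteq> insert v V \<times> insert v V" using assms(3) by blast
  then show "poly (chromatic_polynomial (insert v V) E) (of_nat q) =
      poly ([:0, 1:] * chromatic_polynomial V E) (of_nat q)"
    using assms by (simp add: poly_chromatic_polynomial card_colourings_isolated)
qed

lemma chromatic_polynomial_contract:
  assumes "finite V" "E \<subseteq> V \<times> V" "u \<in> V" "v \<in> V" "u \<noteq> v"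
  shows "chromatic_polynomial V (E \<union> {(u, v), (v, u)}) =
    chromatic_polynomial V E - chromatic_polynomial (V - {v}) (contract u v E)"
proof (rule poly_eqI_naturals)
  fix q
  have E': "E \<union> {(u, v), (v, u)} \<subseteq> V \<times> V" using assms by blast
  show "poly (chromatic_polynomial V (E \<union> {(u, v), (v, u)})) (of_nat q) =
    poly (chromatic_polynomial V E - chromatic_polynomial (V - {v}) (contract u v E)) (of_nat q)"
    unfolding poly_diff poly_chromatic_polynomial[OF assms(1) E']
      poly_chromatic_polynomial[OF assms(1,2)]
      poly_chromatic_polynomial[OF finite_Diff[OF assms(1)] contract_subset[OF assms(2,3,5)]]
      card_colourings_contract[OF assms, of q]
    by simp
qed

text \<open>
  Contracting the new edge gives back the old graph, and deleting it leaves an isolated vertex.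
\<close>

lemma chromatic_polynomial_pendant:
  assumes "finite V" "E \<subseteq> V \<times> V" "u \<in> V" "v \<notin> V"
  shows "chromatic_polynomial (insert v V) (E \<union> {(u, v), (v, u)}) =
    [:-1, 1:] * chromatic_polynomial V E"
proof -
  have "contract u v E = E"
  proof -
    have "map_prod (id(v := u)) (id(v := u)) ` E = (\<lambda>e. e) ` E"
      by (rule image_cong) (use assms in auto)
    then show ?thesis by (simp add: contract_def)
  qed
  moreover have "E \<subseteq> insert v V \<times> insert v V" using assms by blast
  moreover have "insert v V - {v} = V" "u \<noteq> v" using assms(3,4) by auto
  ultimately have "chromatic_polynomial (insert v V) (E \<union> {(u, v), (v, u)}) =
      chromatic_polynomial (insert v V) E - chromatic_polynomial V E"
    using chromatic_polynomial_contract[of "insert v V" E u v] assms(1,3) by simp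
  then show ?thesis
    by (simp add: chromatic_polynomial_isolated[OF assms(1,4,2)])
qed

lemma chromatic_polynomial_glue:
  assumes "finite V1" "finite V2" "V1 \<inter> V2 = {w}" "E1 \<subseteq> V1 \<times> V1" "E2 \<subseteq> V2 \<times> V2"
  shows "[:0, 1:] * chromatic_polynomial (V1 \<union> V2) (E1 \<union> E2) =
    chromatic_polynomial V1 E1 * chromatic_polynomial V2 E2"
proof (rule poly_eqI_naturals)
  fix q
  have "E1 \<union> E2 \<subseteq> (V1 \<union> V2) \<times> (V1 \<union> V2)" using assms by blast
  moreover have "(of_nat q * of_nat (card (colourings (V1 \<union> V2) (E1 \<union> E2) q)) :: rat) =
      of_nat (card (colourings V1 E1 q)) * of_nat (card (colourings V2 E2 q))"
    by (simp only: card_colourings_glue[OF assms] flip: of_nat_mult)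
  ultimately show "poly ([:0, 1:] * chromatic_polynomial (V1 \<union> V2) (E1 \<union> E2)) (of_nat q) =
      poly (chromatic_polynomial V1 E1 * chromatic_polynomial V2 E2) (of_nat q)"
    using assms by (simp add: poly_chromatic_polynomial)
qed

lemma chromatic_polynomial_root_one:
  assumes "finite V" "E \<subseteq> V \<times> V" "E \<noteq> {}"
  shows "poly (chromatic_polynomial V E) 1 = 0"
proof -
  obtain x y where "(x, y) \<in> E" "x \<in> V" "y \<in> V" using assms by fastforce
  then show ?thesis
    using poly_chromatic_polynomial[OF assms(1,2), of 1] colourings_one_empty by fastforce
qed

section \<open>Connectivity\<close>

text \<open>
  Connectedness in terms of cuts: every proper nonempty part of \<open>V\<close> is left by an arc. Edges with an
  end outside \<open>V\<close> are ignored, so deleting a vertex changes only the vertex set. A cut of a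
  contracted graph lifts to a cut of the original one, so no paths have to be rerouted.
\<close>

definition cut_connected :: "'a set \<Rightarrow> 'a rel \<Rightarrow> bool" where
  "cut_connected V E \<longleftrightarrow> V \<noteq> {} \<and> (\<forall>A. A \<noteq> {} \<longrightarrow> A \<subset> V \<longrightarrow> (\<exists>a\<in>A. \<exists>b\<in>V - A. (a, b) \<in> E))"

lemma cut_connectedD:
  assumes "cut_connected V E" "A \<noteq> {}" "A \<subset> V"
  obtains a b where "a \<in> A" "b \<in> V - A" "(a, b) \<in> E"
  using assms unfolding cut_connected_def by blast

lemma cut_connected_restrict: "cut_connected V (E \<inter> V \<times> V) \<longleftrightarrow> cut_connected V E"
proof -
  have "(\<exists>a\<in>A. \<exists>b\<in>V - A. (a, b) \<in> E \<inter> V \<times> V) \<longleftrightarrow> (\<exists>a\<in>A. \<exists>b\<in>V - A. (a, b) \<in> E)"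
    if "A \<subset> V" for A
    using that by blast
  then show ?thesis
    unfolding cut_connected_def by (simp only: cong: imp_cong)
qed

lemma not_cut_connectedE:
  assumes "\<not> cut_connected V E" "V \<noteq> {}" "sym E"
  obtains A B where "A \<noteq> {}" "B \<noteq> {}" "A \<inter> B = {}" "A \<union> B = V"
    "\<And>a b. a \<in> A \<Longrightarrow> b \<in> B \<Longrightarrow> (a, b) \<notin> E \<and> (b, a) \<notin> E"
proof -
  obtain A where A: "A \<noteq> {}" "A \<subset> V" "\<And>a b. a \<in> A \<Longrightarrow> b \<in> V - A \<Longrightarrow> (a, b) \<notin> E"
    using assms(1,2) unfolding cut_connected_def by blast
  show thesis
    by (rule that[of A "V - A"]) (use A assms(3) in \<open>auto dest: symD\<close>)
qed

text \<open>
  In contrast to \<open>two_connected\<close> the single edge \<open>K\<^sub>2\<close> is included; it is the base case of the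
  induction by deletion and contraction.
\<close>

definition biconnected :: "'a set \<Rightarrow> 'a rel \<Rightarrow> bool" where
  "biconnected V E \<longleftrightarrow>
     2 \<le> card V \<and> cut_connected V E \<and> (\<forall>v\<in>V. cut_connected (V - {v}) E)"

abbreviation delete_edge :: "'a \<Rightarrow> 'a \<Rightarrow> 'a rel \<Rightarrow> 'a rel" where
  "delete_edge u v E \<equiv> E - {(u, v), (v, u)}"

lemma cut_connected_contract:
  assumes "cut_connected V E" "u \<in> V" "v \<in> V" "u \<noteq> v"
  shows "cut_connected (V - {v}) (contract u v (delete_edge u v E))"
  unfolding cut_connected_def
proof (intro conjI allI impI)
  show "V - {v} \<noteq> {}" using assms by blast
  fix A assume A: "A \<noteq> {}" "A \<subset> V - {v}"
  define A' where "A' = (if u \<in> A then insert v A else A)"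
  have "A' \<noteq> {}" "A' \<subset> V" using A assms by (auto simp: A'_def)
  then obtain a b where ab: "a \<in> A'" "b \<in> V - A'" "(a, b) \<in> E"
    using cut_connectedD[OF assms(1)] by metis
  then have "(a, b) \<in> delete_edge u v E"
    using A by (auto simp: A'_def split: if_splits)
  then have "((id(v := u)) a, (id(v := u)) b) \<in> contract u v (delete_edge u v E)"
    by (rule contractI)
  moreover have "(id(v := u)) a \<in> A" "(id(v := u)) b \<in> V - {v} - A"
    using ab A assms by (auto simp: A'_def split: if_splits)
  ultimately show "\<exists>a\<in>A. \<exists>b\<in>V - {v} - A. (a, b) \<in> contract u v (delete_edge u v E)"
    by blast
qed

text \<open>
  A graph without cut vertex on at least three vertices has no bridge. If the deleted edge \<open>xy\<close>
  crosses the cut \<open>A\<close> with \<open>x \<in> A\<close>, then one side of the cut has a vertex besides \<open>x\<close> or \<open>y\<close>;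
  removing the end of the edge on that side leaves a cut of a connected graph, which another edge
  has to cross.
\<close>

lemma cut_connected_delete_edge:
  assumes "finite V" "3 \<le> card V" "biconnected V E" "u \<in> V" "v \<in> V" "u \<noteq> v"
  shows "cut_connected V (delete_edge u v E)"
  unfolding cut_connected_def
proof (intro conjI allI impI)
  show "V \<noteq> {}" using assms by blast
  fix A assume A: "A \<noteq> {}" "A \<subset> V"
  have separated: "\<exists>a\<in>A. \<exists>b\<in>V - A. (a, b) \<in> delete_edge x y E"
    if xy: "x \<in> V" "y \<in> V" "x \<in> A" "y \<notin> A" for x y
  proof (cases "A = {x}")
    case False
    then have "A - {x} \<noteq> {}" "A - {x} \<subset> V - {x}" using A xy by auto
    then obtain a b where "a \<in> A - {x}" "b \<in> V - {x} - (A - {x})" "(a, b) \<in> E"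
      using cut_connectedD[of "V - {x}" E "A - {x}"] assms(3) xy by (auto simp: biconnected_def)
    then show ?thesis using xy by blast
  next
    case True
    have "card {x, y} < card V" using assms(2) by (simp add: card_insert_if)
    then have "V \<noteq> {x, y}" by auto
    then have "A \<subset> V - {y}" using True xy A by auto
    then obtain a b where "a \<in> A" "b \<in> V - {y} - A" "(a, b) \<in> E"
      using cut_connectedD[of "V - {y}" E A] assms(3) xy A by (auto simp: biconnected_def)
    then show ?thesis using xy by blast
  qed
  have comm: "delete_edge v u E = delete_edge u v E" by blast
  consider "u \<in> A" "v \<notin> A" | "v \<in> A" "u \<notin> A" | "u \<in> A \<longleftrightarrow> v \<in> A" by blast
  then show "\<exists>a\<in>A. \<exists>b\<in>V - A. (a, b) \<in> delete_edge u v E"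
  proof cases
    case 1
    then show ?thesis using separated assms by blast
  next
    case 2
    then show ?thesis using separated[of v u] assms comm by simp
  next
    case 3
    obtain a b where "a \<in> A" "b \<in> V - A" "(a, b) \<in> E"
      using cut_connectedD[of V E A] assms(3) A by (auto simp: biconnected_def)
    then show ?thesis using 3 by blast
  qed
qed

text \<open>
  Removing a vertex other than \<open>u\<close> commutes with the contraction, and removing the merged vertex
  amounts to removing both ends of the edge. The latter is the only way in which a cut vertex can
  appear.
\<close>

lemma biconnected_contract:
  assumes "finite V" "3 \<le> card V" "biconnected V E" "u \<in> V" "v \<in> V" "u \<noteq> v"
    and rest: "cut_connected (V - {u, v}) E"
  shows "biconnected (V - {v}) (contract u v (delete_edge u v E))"
  unfolding biconnected_def
proof (intro conjI ballI)
  show "2 \<le> card (V - {v})" using assms by simp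
  show "cut_connected (V - {v}) (contract u v (delete_edge u v E))"
    using assms by (intro cut_connected_contract) (auto simp: biconnected_def)
  fix x assume x: "x \<in> V - {v}"
  show "cut_connected (V - {v} - {x}) (contract u v (delete_edge u v E))"
  proof (cases "x = u")
    case False
    then have "cut_connected (V - {x} - {v}) (contract u v (delete_edge u v E))"
      using x assms by (intro cut_connected_contract) (auto simp: biconnected_def)
    moreover have "V - {x} - {v} = V - {v} - {x}" by blast
    ultimately show ?thesis by simp
  next
    case True
    show ?thesis
      unfolding cut_connected_def
    proof (intro conjI allI impI)
      have "V - {u, v} \<noteq> {}" using rest by (simp add: cut_connected_def)
      then show "V - {v} - {x} \<noteq> {}" using True by blast
      fix A assume A: "A \<noteq> {}" "A \<subset> V - {v} - {x}"
      then have "A \<subset> V - {u, v}" using True by blast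
      then obtain a b where ab: "a \<in> A" "b \<in> V - {u, v} - A" "(a, b) \<in> E"
        using cut_connectedD[OF rest A(1)] by metis
      then have "(a, b) \<in> delete_edge u v E" "a \<noteq> v" "b \<noteq> v" using A by auto
      then have "(a, b) \<in> contract u v (delete_edge u v E)"
        using contractI[of a b "delete_edge u v E" v u] by simp
      then show "\<exists>a\<in>A. \<exists>b\<in>V - {v} - {x} - A. (a, b) \<in> contract u v (delete_edge u v E)"
        using ab True by blast
    qed
  qed
qed

text \<open>
  The other half of Tutte's dichotomy. If \<open>x\<close> is a cut vertex after the deletion of \<open>uv\<close>, then
  \<open>uv\<close> is the only edge between two parts \<open>C\<close> and \<open>D\<close> of the remaining vertices. As \<open>u\<close> and \<open>v\<close>
  separate the graph, there is a nonempty \<open>K\<close> that avoids \<open>x\<close> and has no neighbours outside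
  \<open>K \<union> {u, v}\<close>. Both \<open>u\<close> and \<open>v\<close> would have to be attached to \<open>K\<close>, which gives a connection
  from \<open>C\<close> to \<open>D\<close> that avoids both \<open>x\<close> and the edge \<open>uv\<close>.
\<close>

lemma biconnected_delete_edge:
  assumes "finite V" "3 \<le> card V" "biconnected V E" "sym E" "u \<in> V" "v \<in> V" "u \<noteq> v"
    and rest: "\<not> cut_connected (V - {u, v}) E"
  shows "biconnected V (delete_edge u v E)"
proof (rule ccontr)
  assume "\<not> ?thesis"
  then obtain x where x: "x \<in> V" "\<not> cut_connected (V - {x}) (delete_edge u v E)"
    using cut_connected_delete_edge[OF assms(1-3,5-7)] assms(2) by (auto simp: biconnected_def)
  have Vx: "cut_connected (V - {y}) E" if "y \<in> V" for y
    using assms(3) that by (simp add: biconnected_def)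
  have "V - {x} \<noteq> {}" using Vx[OF x(1)] by (simp add: cut_connected_def)
  moreover have "sym (delete_edge u v E)" using assms(4) by (auto simp: sym_def)
  ultimately obtain C D where CD: "C \<noteq> {}" "D \<noteq> {}" "C \<inter> D = {}" "C \<union> D = V - {x}"
    and cut: "\<And>a b. a \<in> C \<Longrightarrow> b \<in> D \<Longrightarrow> (a, b) \<notin> delete_edge u v E \<and> (b, a) \<notin> delete_edge u v E"
    using not_cut_connectedE[OF x(2)] by metis
  have "C \<subset> V - {x}" using CD by blast
  then obtain c d where "c \<in> C" "d \<in> V - {x} - C" "(c, d) \<in> E"
    using cut_connectedD[OF Vx[OF x(1)] CD(1)] by metis
  moreover from this have "d \<in> D" using CD by blast
  ultimately have "(c, d) \<in> {(u, v), (v, u)}" using cut[of c d] by blast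
  then have uv_cut: "u \<in> C \<and> v \<in> D \<or> v \<in> C \<and> u \<in> D" using \<open>c \<in> C\<close> \<open>d \<in> D\<close> by blast
  have "card {u, v} < card V" using assms(2) by (simp add: card_insert_if)
  then have "V \<noteq> {u, v}" by auto
  then have "V - {u, v} \<noteq> {}" using assms(5,6) by blast
  then obtain A B where AB: "A \<noteq> {}" "B \<noteq> {}" "A \<inter> B = {}" "A \<union> B = V - {u, v}"
    and sep: "\<And>a b. a \<in> A \<Longrightarrow> b \<in> B \<Longrightarrow> (a, b) \<notin> E \<and> (b, a) \<notin> E"
    using not_cut_connectedE[OF rest _ assms(4)] by metis
  \<comment> \<open>The parts \<open>A\<close> and \<open>B\<close> are disjoint, so one of them misses \<open>x\<close>.\<close>
  obtain K where K: "K \<noteq> {}" "K \<subseteq> V - {u, v}" "x \<notin> K"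
    and K_sep: "\<And>a b. a \<in> K \<Longrightarrow> b \<in> V - {u, v} - K \<Longrightarrow> (a, b) \<notin> E"
  proof (cases "x \<in> A")
    case True
    show thesis
    proof (rule that[of B])
      show "B \<noteq> {}" "B \<subseteq> V - {u, v}" "x \<notin> B" using AB True by blast+
      show "(a, b) \<notin> E" if "a \<in> B" "b \<in> V - {u, v} - B" for a b
        using sep[of b a] that AB(4) by blast
    qed
  next
    case False
    show thesis
    proof (rule that[of A])
      show "A \<noteq> {}" "A \<subseteq> V - {u, v}" "x \<notin> A" using AB False by blast+
      show "(a, b) \<notin> E" if "a \<in> A" "b \<in> V - {u, v} - A" for a b
        using sep[of a b] that AB(4) by blast
    qed
  qed
  \<comment> \<open>If \<open>K\<close> meets the side \<open>S\<close> containing the end \<open>p\<close> of the edge, then an arc leaving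
    \<open>S \<inter> K\<close> in the graph without \<open>p\<close> would reach \<open>x\<close>, the other side or a vertex outside
    \<open>K \<union> {u, v}\<close>, and none of these is adjacent to \<open>S \<inter> K\<close> there.\<close>
  have stuck: False
    if S: "S \<inter> K \<noteq> {}" "S \<union> T = V - {x}" "S \<inter> T = {}" and pq: "p \<in> S" "q \<in> T"
      and uv: "p = u \<and> q = v \<or> p = v \<and> q = u"
      and no: "\<And>a b. a \<in> S \<Longrightarrow> b \<in> T \<Longrightarrow> (a, b) \<notin> delete_edge u v E" for S T p q
  proof -
    have p: "p \<in> V" using pq S by blast
    have pK: "p \<notin> K" using uv K(2) by blast
    have "S \<inter> K \<subseteq> V - {p}" "q \<in> V - {p}" "q \<notin> S \<inter> K" using K(2) S pq pK by blast+
    then have "S \<inter> K \<subset> V - {p}" by blast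
    then obtain a b where ab: "a \<in> S \<inter> K" "b \<in> V - {p} - S \<inter> K" "(a, b) \<in> E"
      using cut_connectedD[OF Vx[OF p] S(1)] by metis
    have "a \<noteq> u" "a \<noteq> v" using ab(1) K(2) by blast+
    then have "(a, b) \<in> delete_edge u v E" using ab(3) by blast
    then have "b \<notin> T" using no[of a b] ab(1) by blast
    have "b \<noteq> u" "b \<noteq> v" using uv pq(2) ab(2) \<open>b \<notin> T\<close> by auto
    moreover have "b \<in> K"
      using K_sep[of a b] ab \<open>b \<noteq> u\<close> \<open>b \<noteq> v\<close> by blast
    ultimately have "b \<notin> S" using ab(2) by blast
    moreover have "b \<noteq> x" using \<open>b \<in> K\<close> K(3) by blast
    ultimately show False using S(2) \<open>b \<notin> T\<close> ab(2) by blast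
  qed
  have CK: "C \<inter> K \<noteq> {} \<or> D \<inter> K \<noteq> {}" using K CD by blast
  have DC: "D \<union> C = V - {x}" "D \<inter> C = {}" using CD by blast+
  have cutC: "\<And>a b. a \<in> C \<Longrightarrow> b \<in> D \<Longrightarrow> (a, b) \<notin> delete_edge u v E"
    and cutD: "\<And>a b. a \<in> D \<Longrightarrow> b \<in> C \<Longrightarrow> (a, b) \<notin> delete_edge u v E"
    using cut by blast+
  from uv_cut obtain p q where pq: "p \<in> C" "q \<in> D" "p = u \<and> q = v \<or> p = v \<and> q = u" by blast
  then have qp: "q = u \<and> p = v \<or> q = v \<and> p = u" by blast
  from CK show False
  proof
    assume "C \<inter> K \<noteq> {}"
    from stuck[OF this CD(4,3) pq cutC] show False .
  next
    assume "D \<inter> K \<noteq> {}"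
    from stuck[OF this DC pq(2,1) qp cutD] show False .
  qed
qed

lemma connected_iff_cut_connected:
  assumes "sym (arcs_ends H)"
  shows "Digraph_Component.connected H \<longleftrightarrow> cut_connected (verts H) (arcs_ends H)"
proof -
  let ?V = "verts H" and ?E = "arcs_ends H"
  have sc: "?E\<^sup>s = ?E"
    using assms by (auto simp: symcl_def sym_def)
  have conv: "Digraph_Component.connected H \<longleftrightarrow>
      ?V \<noteq> {} \<and> (\<forall>u\<in>?V. \<forall>v\<in>?V. (u, v) \<in> rtrancl_on ?V ?E)"
    by (simp only: connected_conv sc)
  show ?thesis
  proof
    assume con: "Digraph_Component.connected H"
    show "cut_connected ?V ?E"
      unfolding cut_connected_def
    proof (intro conjI allI impI)
      show "?V \<noteq> {}" using con conv by blast
      fix A assume A: "A \<noteq> {}" "A \<subset> ?V"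
      then obtain a b where ab: "a \<in> A" "b \<in> ?V - A" by blast
      show "\<exists>a\<in>A. \<exists>b\<in>?V - A. (a, b) \<in> ?E"
      proof (rule ccontr)
        assume no: "\<not> ?thesis"
        have "(a, b) \<in> rtrancl_on ?V ?E" using con conv A ab by blast
        then have "b \<in> A"
          by (induction rule: rtrancl_on_induct) (use no ab in blast)+
        with ab show False by blast
      qed
    qed
  next
    assume cut: "cut_connected ?V ?E"
    have "(u, v) \<in> rtrancl_on ?V ?E" if uv: "u \<in> ?V" "v \<in> ?V" for u v
    proof (rule ccontr)
      assume no: "(u, v) \<notin> rtrancl_on ?V ?E"
      let ?A = "{w \<in> ?V. (u, w) \<in> rtrancl_on ?V ?E}"
      have "u \<in> ?A" "v \<in> ?V - ?A" using uv no by auto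
      then have "?A \<noteq> {}" "?A \<subset> ?V" by blast+
      from cut_connectedD[OF cut this] obtain a b
        where "a \<in> ?A" "b \<in> ?V - ?A" "(a, b) \<in> ?E" .
      then show False using rtrancl_on_into_rtrancl_on[of u a ?V ?E b] by blast
    qed
    moreover have "?V \<noteq> {}" using cut by (simp add: cut_connected_def)
    ultimately show "Digraph_Component.connected H"
      unfolding conv by blast
  qed
qed

section \<open>The derivative of the chromatic polynomial at one\<close>

text \<open>
  Splitting at the cut vertex \<open>w\<close> gives \<open>q \<chi> = \<chi>\<^sub>1 \<chi>\<^sub>2\<close>. Both parts contain an edge by
  connectedness, so both factors vanish at \<open>1\<close>, and so does the derivative of their product.
\<close>

lemma pderiv_chromatic_polynomial_cut_vertex:
  assumes "finite V" "E \<subseteq> V \<times> V" "sym E" "cut_connected V E"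
    and w: "w \<in> V" "V - {w} \<noteq> {}" "\<not> cut_connected (V - {w}) E"
  shows "poly (pderiv (chromatic_polynomial V E)) 1 = 0"
proof -
  obtain A B where AB: "A \<noteq> {}" "B \<noteq> {}" "A \<inter> B = {}" "A \<union> B = V - {w}"
    and sep: "\<And>a b. a \<in> A \<Longrightarrow> b \<in> B \<Longrightarrow> (a, b) \<notin> E \<and> (b, a) \<notin> E"
    using not_cut_connectedE[OF w(3,2) assms(3)] by metis
  define part where "part C = E \<inter> (insert w C \<times> insert w C)" for C
  have root: "poly (chromatic_polynomial (insert w C) (part C)) 1 = 0"
    if C: "C \<noteq> {}" "C \<subset> V" "w \<notin> C" and no: "\<And>a b. a \<in> C \<Longrightarrow> b \<in> V - insert w C \<Longrightarrow> (a, b) \<notin> E" for C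
  proof (rule chromatic_polynomial_root_one)
    show "finite (insert w C)" using C assms(1) by (meson finite_insert finite_subset psubset_imp_subset)
    show "part C \<subseteq> insert w C \<times> insert w C" by (auto simp: part_def)
    from cut_connectedD[OF assms(4) C(1,2)] obtain a b where "a \<in> C" "b \<in> V - C" "(a, b) \<in> E" .
    then have "(a, b) \<in> part C" using no[of a b] by (auto simp: part_def)
    then show "part C \<noteq> {}" by blast
  qed
  have V: "V = insert w A \<union> insert w B" "A \<subset> V" "B \<subset> V" "w \<notin> A" "w \<notin> B"
    using AB w(1) by auto
  have rA: "poly (chromatic_polynomial (insert w A) (part A)) 1 = 0"
  proof (rule root[OF AB(1) V(2,4)])
    show "(a, b) \<notin> E" if "a \<in> A" "b \<in> V - insert w A" for a b
      using sep[of a b] that AB(4) by blast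
  qed
  have rB: "poly (chromatic_polynomial (insert w B) (part B)) 1 = 0"
  proof (rule root[OF AB(2) V(3,5)])
    show "(a, b) \<notin> E" if "a \<in> B" "b \<in> V - insert w B" for a b
      using sep[of b a] that AB(4) by blast
  qed
  have "E = part A \<union> part B"
  proof
    show "E \<subseteq> part A \<union> part B"
    proof
      fix e assume e: "e \<in> E"
      obtain a b where [simp]: "e = (a, b)" by (cases e)
      have "a \<in> insert w A \<union> insert w B" "b \<in> insert w A \<union> insert w B"
        using e assms(2) V(1) by auto
      then show "e \<in> part A \<union> part B"
        using e sep[of a b] sep[of b a] by (auto simp: part_def)
    qed
  qed (auto simp: part_def)
  moreover have "insert w A \<inter> insert w B = {w}" using AB(3) V(4,5) by auto
  moreover have "finite A" "finite B"
    using V(2,3) assms(1) by (meson finite_subset psubset_imp_subset)+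
  moreover have "part A \<subseteq> insert w A \<times> insert w A" "part B \<subseteq> insert w B \<times> insert w B"
    by (auto simp: part_def)
  ultimately have "[:0, 1:] * chromatic_polynomial V E =
      chromatic_polynomial (insert w A) (part A) * chromatic_polynomial (insert w B) (part B)"
    using chromatic_polynomial_glue[of "insert w A" "insert w B" w "part A" "part B"]
    unfolding V(1)[symmetric] by simp
  then have "poly (pderiv ([:0, 1:] * chromatic_polynomial V E)) 1 =
      poly (pderiv (chromatic_polynomial (insert w A) (part A) *
        chromatic_polynomial (insert w B) (part B))) 1"
    by (simp only:)
  also have "\<dots> = 0"
    by (simp add: pderiv_mult rA rB)
  also have "poly (pderiv ([:0, 1:] * chromatic_polynomial V E)) 1 =
      poly (chromatic_polynomial V E) 1 + poly (pderiv (chromatic_polynomial V E)) 1"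
    by (simp add: pderiv_mult pderiv_pCons)
  also have "poly (chromatic_polynomial V E) 1 = 0"
  proof (rule chromatic_polynomial_root_one[OF assms(1,2)])
    from cut_connectedD[OF assms(4) AB(1) V(2)] show "E \<noteq> {}" by blast
  qed
  finally show ?thesis by simp
qed

lemma contract_delete_edge_simple:
  assumes "E \<subseteq> V \<times> V" "sym E" "irrefl E" "u \<in> V" "u \<noteq> v"
  shows "contract u v (delete_edge u v E) \<subseteq> (V - {v}) \<times> (V - {v})"
    "sym (contract u v (delete_edge u v E))" "irrefl (contract u v (delete_edge u v E))"
proof -
  show "contract u v (delete_edge u v E) \<subseteq> (V - {v}) \<times> (V - {v})"
    using assms by (intro contract_subset) auto
  show "sym (contract u v (delete_edge u v E))"
  proof (rule symI)
    fix x y assume "(x, y) \<in> contract u v (delete_edge u v E)"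
    then obtain a b where ab: "(a, b) \<in> delete_edge u v E" "x = (id(v := u)) a" "y = (id(v := u)) b"
      by (rule contractE)
    then have "(b, a) \<in> delete_edge u v E" using assms(2) by (auto dest: symD)
    then show "(y, x) \<in> contract u v (delete_edge u v E)"
      unfolding ab(2,3) by (rule contractI)
  qed
  show "irrefl (contract u v (delete_edge u v E))"
  proof (rule irreflI)
    fix x show "(x, x) \<notin> contract u v (delete_edge u v E)"
    proof
      assume "(x, x) \<in> contract u v (delete_edge u v E)"
      then obtain a b where ab: "(a, b) \<in> delete_edge u v E" "(id(v := u)) a = (id(v := u)) b"
        by (metis contractE)
      moreover have "a \<noteq> b" using ab(1) assms(3) by (auto dest: irreflD)
      ultimately show False by (auto split: if_splits)
    qed
  qed
qed

lemma pderiv_chromatic_polynomial_single_edge: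
  assumes "u \<noteq> v"
  shows "poly (pderiv (chromatic_polynomial {u, v} {(u, v), (v, u)})) 1 = 1"
proof -
  have "{u, v} - {v} = {u}" using assms by auto
  then have "chromatic_polynomial {u, v} {(u, v), (v, u)} = monom 1 2 - monom 1 1"
    using assms chromatic_polynomial_contract[of "{u, v}" "{}" u v]
    by (simp add: chromatic_polynomial_empty contract_def numeral_2_eq_2)
  then show ?thesis by (simp add: pderiv_diff pderiv_monom poly_monom)
qed

text \<open>
  The factor \<open>(-1)\<^bsup>card V\<^esup>\<close> turns the difference in the deletion-contraction rule into a sum, as
  contraction removes one vertex. The statement covers all connected graphs, with value \<open>0\<close> in
  the presence of a cut vertex, because only one of the two smaller graphs is known to be
  biconnected; for the other one it is enough that its term is not negative.
\<close>

lemma pderiv_chromatic_polynomial_sign: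
  assumes "finite V" "E \<subseteq> V \<times> V" "sym E" "irrefl E" "cut_connected V E" "2 \<le> card V"
  shows "if biconnected V E then 0 < (-1) ^ card V * poly (pderiv (chromatic_polynomial V E)) 1
    else poly (pderiv (chromatic_polynomial V E)) 1 = 0"
  using assms
proof (induction "card V + card E" arbitrary: V E rule: less_induct)
  case less
  note fin = less.prems(1) and E = less.prems(2-4) and con = less.prems(5) and card = less.prems(6)
  have fE: "finite E" using fin E(1) by (meson finite_SigmaI finite_subset)
  show ?case
  proof (cases "biconnected V E")
    case False
    then obtain w where w: "w \<in> V" "\<not> cut_connected (V - {w}) E"
      using con card by (auto simp: biconnected_def)
    have "V \<noteq> {w}" using card by auto
    with w have "V - {w} \<noteq> {}" by blast
    with False show ?thesis
      using pderiv_chromatic_polynomial_cut_vertex[OF fin E(1,2) con w(1) _ w(2)] by simp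
  next
    case True
    obtain u0 where u0: "u0 \<in> V" using con by (auto simp: cut_connected_def)
    have "V \<noteq> {u0}" using card by auto
    with u0 have "{u0} \<noteq> {}" "{u0} \<subset> V" by auto
    from cut_connectedD[OF con this] obtain u v where uvE: "(u, v) \<in> E" .
    then have uv: "u \<in> V" "v \<in> V" "u \<noteq> v" "(v, u) \<in> E" using E by (auto dest: symD irreflD)
    \<comment> \<open>\<open>D\<close> and \<open>C\<close> are the edge sets after deletion and after contraction of \<open>uv\<close>.\<close>
    define D where "D = delete_edge u v E"
    define C where "C = contract u v D"
    have D: "D \<subseteq> V \<times> V" "sym D" "irrefl D" "D \<union> {(u, v), (v, u)} = E"
      using E uvE uv by (auto simp: D_def sym_def irrefl_def)
    have "D \<subset> E" using uvE by (auto simp: D_def)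
    then have cardD: "card D < card E" using fE by (rule psubset_card_mono[rotated])
    have "chromatic_polynomial V E = chromatic_polynomial V D - chromatic_polynomial (V - {v}) C"
      using chromatic_polynomial_contract[OF fin D(1) uv(1-3)] D(4) by (simp add: C_def)
    then have deriv: "poly (pderiv (chromatic_polynomial V E)) 1 =
        poly (pderiv (chromatic_polynomial V D)) 1 - poly (pderiv (chromatic_polynomial (V - {v}) C)) 1"
      by (simp add: pderiv_diff)
    show ?thesis
    proof (cases "card V = 2")
      case True
      moreover have "card {u, v} = 2" using uv by simp
      ultimately have V: "V = {u, v}"
        using uv fin card_subset_eq[of V "{u, v}"] by simp
      then have "E = {(u, v), (v, u)}" using E uvE uv by (auto dest: irreflD)
      with V show ?thesis
        using \<open>biconnected V E\<close> uv by (simp add: pderiv_chromatic_polynomial_single_edge)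
    next
      case False
      then have card3: "3 \<le> card V" using card by simp
      let ?d = "(-1) ^ card V * poly (pderiv (chromatic_polynomial V D)) 1"
      let ?c = "(-1) ^ card (V - {v}) * poly (pderiv (chromatic_polynomial (V - {v}) C)) 1"
      have card': "card V = Suc (card (V - {v}))" using uv fin by (metis card_Suc_Diff1)
      have "card V + card D < card V + card E" using cardD by simp
      from less.hyps[OF this fin D(1-3)
          cut_connected_delete_edge[OF fin card3 True uv(1-3), folded D_def] card]
      have d: "if biconnected V D then 0 < ?d else ?d = 0" by (auto split: if_splits)
      have C: "C \<subseteq> (V - {v}) \<times> (V - {v})" "sym C" "irrefl C"
        using contract_delete_edge_simple[OF E uv(1,3)] by (simp_all add: C_def D_def)
      have "card C \<le> card D"
        unfolding C_def contract_def by (rule card_image_le) (simp add: D_def fE)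
      then have "card (V - {v}) + card C < card V + card E" using card' cardD by simp
      from less.hyps[OF this _ C] cut_connected_contract[OF con uv(1-3)] card3 card' fin
      have c: "if biconnected (V - {v}) C then 0 < ?c else ?c = 0"
        by (auto simp: C_def D_def split: if_splits)
      have "biconnected V D \<or> biconnected (V - {v}) C"
        using biconnected_contract[OF fin card3 True uv(1-3)]
          biconnected_delete_edge[OF fin card3 True E(2) uv(1-3)] by (auto simp: C_def D_def)
      then have "0 < ?d + ?c" using c d by (auto split: if_splits)
      moreover have "(-1) ^ card V * poly (pderiv (chromatic_polynomial V E)) 1 = ?d + ?c"
        by (simp add: deriv card' algebra_simps)
      ultimately show ?thesis using True by simp
    qed
  qed
qed

section \<open>Specialising symmetric functions to finitely many colours\<close>

text \<open>
  The monomials of degree \<open>n\<close> in \<open>x\<^sub>1, \<dots>, x\<^sub>q\<close>, which are those that contribute to the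
  specialisation of a homogeneous series of degree \<open>n\<close> at \<open>q\<close> ones.
\<close>

definition monomials :: "nat \<Rightarrow> nat \<Rightarrow> nat multiset set" where
  "monomials n q = {m. size m = n \<and> set_mset m \<subseteq> {1..q}}"

lemma finite_monomials: "finite (monomials n q)"
proof (rule finite_subset)
  show "monomials n q \<subseteq> mset ` {xs. set xs \<subseteq> {1..q} \<and> length xs = n}"
  proof
    fix m assume m: "m \<in> monomials n q"
    obtain xs where xs: "mset xs = m" using ex_mset by blast
    then have "xs \<in> {xs. set xs \<subseteq> {1..q} \<and> length xs = n}"
      using m by (auto simp: monomials_def)
    with xs show "m \<in> mset ` {xs. set xs \<subseteq> {1..q} \<and> length xs = n}" by blast
  qed
  show "finite (mset ` {xs. set xs \<subseteq> {1..q} \<and> length xs = n})"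
    by (intro finite_imageI finite_lists_length_eq) simp
qed

lemma sum_chromatic_symmetric_function:
  assumes "finite (pverts G)" "card (pverts G) = n"
  shows "(\<Sum>m\<in>monomials n q. chromatic_symmetric_function G m) =
    of_nat (card (colourings (pverts G) (parcs G) q))"
proof -
  let ?S = "colourings (pverts G) (parcs G) q"
  have set: "set_mset (colouring_monomial G \<kappa>) = \<kappa> ` pverts G" for \<kappa>
    using assms(1) by (simp add: colouring_monomial_def)
  have "{\<kappa> \<in> proper_colourings G. colouring_monomial G \<kappa> = m} =
      {\<kappa> \<in> ?S. colouring_monomial G \<kappa> = m}" if "m \<in> monomials n q" for m
  proof -
    have "\<kappa> \<in> proper_colourings G \<longleftrightarrow> \<kappa> \<in> ?S" if "colouring_monomial G \<kappa> = m" for \<kappa>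
    proof -
      have "\<kappa> ` pverts G \<subseteq> {1..q}"
        using set[of \<kappa>] that \<open>m \<in> monomials n q\<close> by (simp add: monomials_def)
      then show ?thesis
        by (auto simp: proper_colourings_def colourings_def PiE_iff)
    qed
    then show ?thesis by blast
  qed
  then have "(\<Sum>m\<in>monomials n q. card {\<kappa> \<in> proper_colourings G. colouring_monomial G \<kappa> = m}) =
      (\<Sum>m\<in>monomials n q. card {\<kappa> \<in> ?S. colouring_monomial G \<kappa> = m})"
    by (intro sum.cong) simp_all
  also have "\<dots> = (\<Sum>m\<in>monomials n q. \<Sum>\<kappa>\<in>{\<kappa> \<in> ?S. colouring_monomial G \<kappa> = m}. 1)"
    by simp
  also have "\<dots> = (\<Sum>\<kappa>\<in>?S. 1)"
  proof (rule sum.group)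
    show "finite ?S" by (rule finite_colourings[OF assms(1)])
    show "colouring_monomial G ` ?S \<subseteq> monomials n q"
    proof (rule image_subsetI)
      fix \<kappa> assume "\<kappa> \<in> ?S"
      then have "\<kappa> ` pverts G \<subseteq> {1..q}"
        by (intro image_subsetI) (rule colouringsD(1))
      then show "colouring_monomial G \<kappa> \<in> monomials n q"
        using set[of \<kappa>] assms by (simp add: monomials_def colouring_monomial_def)
    qed
  qed (rule finite_monomials)
  finally have eq: "(\<Sum>m\<in>monomials n q. card {\<kappa> \<in> proper_colourings G. colouring_monomial G \<kappa> = m}) =
      card ?S"
    by simp
  show ?thesis
    unfolding chromatic_symmetric_function_def eq[symmetric] by simp
qed

section \<open>Star forests\<close>

lemma pverts_star_forest: "pverts (star_forest l) = {(i, v). i < length l \<and> v < l ! i}"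
  by (auto simp: star_forest_def disjoint_union_def star_def)

lemma parcs_star_forest:
  "parcs (star_forest l) =
    {((i, u), (i, v)) |i u v. i < length l \<and> u < l ! i \<and> v < l ! i \<and> (u = 0 \<and> v \<noteq> 0 \<or> u \<noteq> 0 \<and> v = 0)}"
  by (auto simp: star_forest_def disjoint_union_def star_def)

lemma star_forest_simple:
  "finite (pverts (star_forest l))" "parcs (star_forest l) \<subseteq> pverts (star_forest l) \<times> pverts (star_forest l)"
proof -
  interpret pair_graph "star_forest l" by (rule pair_graph_star_forest)
  show "finite (pverts (star_forest l))" by (rule pair_finite_verts)
  show "parcs (star_forest l) \<subseteq> pverts (star_forest l) \<times> pverts (star_forest l)"
    using in_arcsD1 in_arcsD2 by auto
qed

lemma star_forest_new_star:
  "pverts (star_forest (l @ [Suc 0])) = insert (length l, 0) (pverts (star_forest l))"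
  "parcs (star_forest (l @ [Suc 0])) = parcs (star_forest l)"
  by (auto simp: pverts_star_forest parcs_star_forest nth_append less_Suc_eq split: if_splits)

lemma star_forest_new_leaf:
  assumes "k \<ge> 1"
  shows "pverts (star_forest (l @ [Suc k])) = insert (length l, k) (pverts (star_forest (l @ [k])))"
    "parcs (star_forest (l @ [Suc k])) =
      parcs (star_forest (l @ [k])) \<union> {((length l, 0), (length l, k)), ((length l, k), (length l, 0))}"
  using assms
  by (auto simp: pverts_star_forest parcs_star_forest nth_append less_Suc_eq split: if_splits)

text \<open>
  A star forest grows by an isolated vertex, which opens a new star and contributes a factor
  \<open>q\<close>, or by a leaf of the last star, which contributes a factor \<open>q - 1\<close>.
\<close>

lemma chromatic_polynomial_star_forest:
  assumes "\<forall>k\<in>set l. 1 \<le> k"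
  shows "card (pverts (star_forest l)) = sum_list l" (is ?card)
    and "chromatic_polynomial (pverts (star_forest l)) (parcs (star_forest l)) =
      [:0, 1:] ^ length l * [:-1, 1:] ^ (sum_list l - length l)" (is ?poly)
proof -
  have "length l \<le> sum_list l \<and> ?card \<and> ?poly"
    using assms
  proof (induction l rule: rev_induct)
    case Nil
    have "pverts (star_forest []) = {}" "parcs (star_forest []) = {}"
      by (simp_all add: pverts_star_forest parcs_star_forest)
    then show ?case by (simp add: chromatic_polynomial_empty)
  next
    case (snoc k l)
    have "1 \<le> k" using snoc.prems by simp
    then show ?case
    proof (induction k rule: dec_induct)
      case base
      have IH: "length l \<le> sum_list l" "card (pverts (star_forest l)) = sum_list l"
        "chromatic_polynomial (pverts (star_forest l)) (parcs (star_forest l)) =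
          [:0, 1:] ^ length l * [:-1, 1:] ^ (sum_list l - length l)"
        using snoc by auto
      have new: "(length l, 0) \<notin> pverts (star_forest l)" by (simp add: pverts_star_forest)
      show ?case
        using IH new star_forest_simple[of l]
          chromatic_polynomial_isolated[OF star_forest_simple(1) new star_forest_simple(2)]
        by (simp only: One_nat_def star_forest_new_star) (simp add: mult.assoc)
    next
      case (step k)
      have new: "(length l, k) \<notin> pverts (star_forest (l @ [k]))"
        and old: "(length l, 0) \<in> pverts (star_forest (l @ [k]))"
        using step.hyps by (simp_all add: pverts_star_forest)
      have len: "length (l @ [k]) \<le> sum_list (l @ [k])" using step.IH by blast
      then have exp: "sum_list (l @ [Suc k]) - length (l @ [Suc k]) =
          Suc (sum_list (l @ [k]) - length (l @ [k]))" "length (l @ [Suc k]) = length (l @ [k])"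
        by simp_all
      have "chromatic_polynomial (pverts (star_forest (l @ [Suc k]))) (parcs (star_forest (l @ [Suc k]))) =
          [:-1, 1:] * chromatic_polynomial (pverts (star_forest (l @ [k]))) (parcs (star_forest (l @ [k])))"
        unfolding star_forest_new_leaf[OF step.hyps(1)]
        by (rule chromatic_polynomial_pendant[OF star_forest_simple old new])
      also have "\<dots> = [:0, 1:] ^ length (l @ [Suc k]) *
          [:-1, 1:] ^ (sum_list (l @ [Suc k]) - length (l @ [Suc k]))"
        unfolding exp(1) unfolding exp(2) power_Suc using step.IH by (simp only: mult.left_commute)
      finally have "chromatic_polynomial (pverts (star_forest (l @ [Suc k])))
          (parcs (star_forest (l @ [Suc k]))) = \<dots>" .
      moreover have "card (pverts (star_forest (l @ [Suc k]))) = sum_list (l @ [Suc k])"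
        unfolding star_forest_new_leaf[OF step.hyps(1)]
        using step.IH new star_forest_simple(1)[of "l @ [k]"] by simp
      moreover have "length (l @ [Suc k]) \<le> sum_list (l @ [Suc k])" using len by simp
      ultimately show ?case by blast
    qed
  qed
  then show ?card ?poly by blast+
qed

section \<open>Reading off the coefficient\<close>

lemma sum_list_eq_length_iff:
  assumes "\<forall>k\<in>set l. 1 \<le> k"
  shows "length l \<le> sum_list l" "sum_list l = length l \<Longrightarrow> l = replicate (length l) (1::nat)"
proof -
  have "length l \<le> sum_list l \<and> (sum_list l = length l \<longrightarrow> l = replicate (length l) 1)"
    using assms by (induction l) auto
  then show "length l \<le> sum_list l" "sum_list l = length l \<Longrightarrow> l = replicate (length l) 1"
    by blast+
qed

lemma partition_excess_one:
  assumes "l \<in> partitions n" "n - length l = 1"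
  shows "l = 2 # replicate (n - 2) 1"
proof (cases l)
  case Nil
  then show ?thesis using assms by (auto simp: partitions_def)
next
  case (Cons x xs)
  have l: "\<forall>k\<in>set xs. 1 \<le> k \<and> k \<le> x" "1 \<le> x" "x + sum_list xs = n"
    using assms(1) Cons by (auto simp: partitions_def)
  note xs = sum_list_eq_length_iff[of xs]
  have "x \<noteq> 1"
  proof
    assume "x = 1"
    with l have "\<forall>k\<in>set xs. k = 1" by fastforce
    then have "sum_list xs = length xs" by (induction xs) auto
    then show False using assms(2) Cons l \<open>x = 1\<close> by simp
  qed
  moreover have "x + sum_list xs = length xs + 2" using l Cons assms(2) by simp
  ultimately have "x = 2" "sum_list xs = length xs" using xs(1) l by auto
  then show ?thesis using xs(2) l Cons by auto
qed

lemma poly_pderiv_powers_at_one: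
  "poly (pderiv ([:0, 1:] ^ a * [:-1, 1:] ^ b)) (1 :: 'a :: idom) =
    of_nat a * 0 ^ b + of_nat b * 0 ^ (b - 1)"
  by (simp add: pderiv_mult pderiv_power pderiv_pCons)

text \<open>
  Both sides of the expansion are polynomials in the number of colours. A partition with
  \<open>n - length l \<ge> 2\<close> contributes a multiple of \<open>(q - 1)\<^sup>2\<close>, and \<open>1\<^sup>n\<close> has coefficient \<open>\<chi>(1) = 0\<close>,
  so the derivative at \<open>1\<close> sees a single partition.
\<close>

lemma star_coefficient_eq_pderiv:
  assumes "pair_graph G" "parcs G \<noteq> {}" "card (pverts G) = n" "2 \<le> n"
    and expansion: "chromatic_symmetric_function G = (\<lambda>m. \<Sum>l \<in> partitions n. c l * star_basis l m)"
  shows "c (2 # replicate (n - 2) 1) = poly (pderiv (chromatic_polynomial (pverts G) (parcs G))) 1"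
proof -
  interpret pair_graph G by (rule assms(1))
  have G: "finite (pverts G)" "parcs G \<subseteq> pverts G \<times> pverts G"
    using pair_finite_verts in_arcsD1 in_arcsD2 by auto
  let ?\<chi> = "chromatic_polynomial (pverts G) (parcs G)"
  let ?f = "\<lambda>l. [:0, 1:] ^ length l * [:-1, 1:] ^ (n - length l) :: rat poly"
  let ?ones = "replicate n 1 :: nat list" and ?two = "2 # replicate (n - 2) 1 :: nat list"
  have part: "l \<in> partitions n \<Longrightarrow> \<forall>k\<in>set l. 1 \<le> k" "l \<in> partitions n \<Longrightarrow> sum_list l = n" for l
    by (auto simp: partitions_def)
  have \<chi>: "?\<chi> = (\<Sum>l\<in>partitions n. smult (c l) (?f l))"
  proof (rule poly_eqI_naturals)
    fix q
    have "poly ?\<chi> (of_nat q) = (\<Sum>m\<in>monomials n q. chromatic_symmetric_function G m)"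
      using G assms(3) by (simp add: poly_chromatic_polynomial sum_chromatic_symmetric_function)
    also have "\<dots> = (\<Sum>l\<in>partitions n. c l * (\<Sum>m\<in>monomials n q. star_basis l m))"
      unfolding expansion sum_distrib_left by (rule sum.swap)
    also have "\<dots> = (\<Sum>l\<in>partitions n. c l * poly (?f l) (of_nat q))"
    proof (rule sum.cong)
      fix l assume l: "l \<in> partitions n"
      have "card (pverts (star_forest l)) = n"
        using chromatic_polynomial_star_forest(1)[OF part(1)[OF l]] part(2)[OF l] by simp
      then have "(\<Sum>m\<in>monomials n q. star_basis l m) =
          poly (chromatic_polynomial (pverts (star_forest l)) (parcs (star_forest l))) (of_nat q)"
        unfolding star_basis_def poly_chromatic_polynomial[OF star_forest_simple]
        by (rule sum_chromatic_symmetric_function[OF star_forest_simple(1)])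
      then show "c l * (\<Sum>m\<in>monomials n q. star_basis l m) = c l * poly (?f l) (of_nat q)"
        using chromatic_polynomial_star_forest(2)[OF part(1)[OF l]] part(2)[OF l] by simp
    qed simp
    finally show "poly ?\<chi> (of_nat q) = poly (\<Sum>l\<in>partitions n. smult (c l) (?f l)) (of_nat q)"
      by (simp add: poly_sum)
  qed
  have ones: "?ones \<in> partitions n" and two: "?two \<in> partitions n"
    using assms(4) by (auto simp: partitions_def sorted_wrt_iff_nth_less nth_Cons sum_list_replicate split: nat.split)
  have neq: "?ones \<noteq> ?two" using assms(4) by (cases n) auto
  \<comment> \<open>The three cases are \<open>n - l = 0\<close>, \<open>n - l = 1\<close> and \<open>n - l \<ge> 2\<close> for a partition of length \<open>l\<close>;
    \<open>partition_excess_one\<close> identifies the second.\<close>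
  have shape: "l = ?ones \<or> l = ?two \<or> 2 \<le> n - length l" if l: "l \<in> partitions n" for l
  proof -
    have "l = ?ones" if "n - length l = 0"
      using sum_list_eq_length_iff[OF part(1)[OF l]] part(2)[OF l] that by simp
    then show ?thesis using partition_excess_one[OF l] by linarith
  qed
  have at_one: "poly (?f l) 1 = (if l = ?ones then 1 else 0)" if l: "l \<in> partitions n" for l
    using shape[OF l] neq assms(4) by auto
  have slope: "poly (pderiv (?f l)) 1 = (if l = ?ones then of_nat n else 0) + (if l = ?two then 1 else 0)"
    if l: "l \<in> partitions n" for l
    using shape[OF l]
  proof (elim disjE)
    assume l1: "l = ?ones"
    then have "length l = n" by simp
    with l1 neq show ?thesis unfolding poly_pderiv_powers_at_one by simp
  next
    assume l2: "l = ?two"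
    then have "n - length l = 1" using assms(4) by simp
    moreover have "l \<noteq> ?ones" using l2 neq by metis
    ultimately show ?thesis using l2 unfolding poly_pderiv_powers_at_one by simp
  next
    assume l3: "2 \<le> n - length l"
    then have "l \<noteq> ?ones" "l \<noteq> ?two" by auto
    moreover have "n - length l \<noteq> 0" "n - length l - 1 \<noteq> 0" using l3 by auto
    ultimately show ?thesis unfolding poly_pderiv_powers_at_one by (simp only: power_0_left if_False mult_zero_right add_0_right)
  qed
  have pick: "(\<Sum>l\<in>partitions n. c l * (if l = k then x else 0)) = c k * x"
    if "k \<in> partitions n" for k x
    using that by (simp add: if_distrib[of "(*) _"] sum.delta finite_partitions cong: if_cong)
  have "poly ?\<chi> 1 = (\<Sum>l\<in>partitions n. c l * (if l = ?ones then 1 else 0))"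
    unfolding \<chi> poly_sum poly_smult by (rule sum.cong) (simp_all only: at_one)
  also have "\<dots> = c ?ones"
    unfolding pick[OF ones] by (rule mult_1_right)
  finally have c_ones: "c ?ones = 0"
    using chromatic_polynomial_root_one[OF G assms(2)] by simp
  have "poly (pderiv ?\<chi>) 1 = (\<Sum>l\<in>partitions n. c l * poly (pderiv (?f l)) 1)"
    unfolding \<chi> by (simp add: higher_pderiv_sum[of 1, simplified] pderiv_smult poly_sum)
  also have "\<dots> = (\<Sum>l\<in>partitions n.
      c l * ((if l = ?ones then of_nat n else 0) + (if l = ?two then 1 else 0)))"
    by (rule sum.cong) (simp_all only: slope)
  also have "\<dots> = c ?ones * of_nat n + c ?two"
    unfolding distrib_left sum.distrib pick[OF ones] pick[OF two] by simp
  finally show ?thesis using c_ones by simp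
qed

section \<open>Two-connectedness and the star coefficient\<close>

theorem theorem1p2:
  fixes G :: "'a pair_pre_digraph" and n :: nat and c :: "nat list \<Rightarrow> rat"
  assumes "pair_graph G"
    and "Digraph_Component.connected (with_proj G)"
    and "card (pverts G) = n"
    and "n \<ge> 3"
    and "chromatic_symmetric_function G = (\<lambda>m. \<Sum>l \<in> partitions n. c l * star_basis l m)"
  shows "c (2 # replicate (n - 2) 1) \<noteq> 0 \<longleftrightarrow> two_connected G"
proof -
  interpret pair_graph G by (rule assms(1))
  have G: "finite (pverts G)" "parcs G \<subseteq> pverts G \<times> pverts G" "sym (parcs G)" "irrefl (parcs G)"
    using pair_finite_verts in_arcsD1 in_arcsD2 pair_sym_arcs pair_no_loops[of "(x, x)" for x]
    by (auto simp: symmetric_def irrefl_def)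
  have con: "cut_connected (pverts G) (parcs G)"
    using assms(2) connected_iff_cut_connected[of "with_proj G"] G(3) by simp
  have "Digraph_Component.connected (pre_digraph.del_vert (with_proj G) v) \<longleftrightarrow>
      cut_connected (pverts G - {v}) (parcs G)" for v
  proof -
    have arcs: "arcs_ends (pre_digraph.del_vert (with_proj G) v) =
        parcs G \<inter> (pverts G - {v}) \<times> (pverts G - {v})"
      using G(2) by (auto simp: arcs_ends_conv pre_digraph.del_vert_simps)
    then have "sym (arcs_ends (pre_digraph.del_vert (with_proj G) v))"
      using G(3) by (auto simp: sym_def)
    then show ?thesis
      using connected_iff_cut_connected[of "pre_digraph.del_vert (with_proj G) v"]
      by (simp add: arcs pre_digraph.verts_del_vert cut_connected_restrict)
  qed
  then have bic: "two_connected G \<longleftrightarrow> biconnected (pverts G) (parcs G)"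
    using assms(3,4) con by (auto simp: two_connected_def biconnected_def)
  have "parcs G \<noteq> {}"
  proof -
    obtain u where u: "u \<in> pverts G" using con by (auto simp: cut_connected_def)
    have "pverts G \<noteq> {u}" using assms(3,4) by auto
    with u have "{u} \<noteq> {}" "{u} \<subset> pverts G" by auto
    from cut_connectedD[OF con this] show ?thesis by blast
  qed
  then have "c (2 # replicate (n - 2) 1) = poly (pderiv (chromatic_polynomial (pverts G) (parcs G))) 1"
    using star_coefficient_eq_pderiv[OF assms(1) _ assms(3) _ assms(5)] assms(4) by simp
  then show ?thesis
    using pderiv_chromatic_polynomial_sign[OF G con] assms(3,4) bic by (auto split: if_splits)
qed

end
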